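(* For every $\alpha>0$, there exist a constant $\tau_\alpha>0$, a distribution in $\mathcal G_{\alpha,\tau_\alpha}$ with density $f_\alpha^{(0)}$, and positive constants $C_{\alpha,1},C_{\alpha,2}$ depending only on $\alpha$, such that for every $\gamma\in\mathbb{R}$, with $f_\alpha^{(1)}(\cdot):=f_\alpha^{(0)}(\cdot-\gamma)$, $$1+\chi^2\big(f_\alpha^{(1)}\,\|\,f_\alpha^{(0)}\big)\ \le\ C_{\alpha,1}\exp\left(\left|\frac{\gamma}{C_{\alpha,2}}\right|^\alpha\right).$$ Moreover, for $\alpha\le1$ and for $\alpha=2$ one can take $C_{\alpha,1}=1$.
   Context: For $\alpha,\tau>0$, $\mathcal G_{\alpha,\tau}$ is the class of distributions on $\mathbb{R}$ of random variables $W$ that are symmetric around $0$, satisfy $\mathbb{E}(W^2)=1$, and $\mathbb{P}(|W|\ge t)\le2\exp\{-2(t/\tau)^\alpha\}$ for all $t\ge0$. For probability measures (identified with densities) $P,Q$, $\chi^2(P\,\|\,Q)=\int(\frac{dP}{dQ}-1)^2\,dQ$. *)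

theory Defs
  imports "HOL-Probability.Probability"
begin

definition class_G :: "real \<Rightarrow> real \<Rightarrow> real measure set" where
  "class_G \<alpha> \<tau> =
     {M. prob_space M \<and> sets M = sets borel \<and>
         distr M borel (\<lambda>w. - w) = M \<and>
         integrable M (\<lambda>w. w\<^sup>2) \<and> (\<integral>w. w\<^sup>2 \<partial>M) = 1 \<and>
         (\<forall>t\<ge>0. measure M {w. \<bar>w\<bar> \<ge> t} \<le> 2 * exp (- 2 * (t / \<tau>) powr \<alpha>))}"

text \<open>
  The divergence takes values in \<^typ>\<open>ennreal\<close>, so that a divergent integral is infinite (a Bochner
  integral would be 0); it is also infinite when \<open>P\<close> is not absolutely continuous with respect
  to \<open>Q\<close>. For finite \<open>P\<close> the Radon-Nikodym derivative is finite \<open>Q\<close>-almost everywhere, so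
  \<^const>\<open>enn2real\<close> does not affect the integral.
\<close>

definition chi_square :: "'a measure \<Rightarrow> 'a measure \<Rightarrow> ennreal" where
  "chi_square P Q =
     (if absolutely_continuous Q P
      then \<integral>\<^sup>+ x. ennreal ((enn2real (RN_deriv Q P x) - 1)\<^sup>2) \<partial>Q
      else \<infinity>)"

end

theory Submission
  imports Defs
begin

text \<open>
  Take \<open>f(x) = c exp(-b |x|^\<alpha>)\<close>, with \<open>b\<close> and \<open>c\<close> normalised to unit mass and variance.
  Then \<open>1 + \<chi>\<^sup>2\<close> is the integral of \<open>f(x - \<gamma>)\<^sup>2 / f(x) = c exp(b |x|^\<alpha> - 2 b |x - \<gamma>|^\<alpha>)\<close>.
  For \<open>\<alpha> \<le> 1\<close>, subadditivity of \<open>|x|^\<alpha>\<close> bounds the integrand by \<open>exp(b |\<gamma>|^\<alpha>) f(x - \<gamma>)\<close>;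
  for \<open>\<alpha> = 2\<close>, completing the square gives \<open>exp(2 b \<gamma>\<^sup>2) f(x - 2 \<gamma>)\<close> exactly. Both translates
  have mass 1, hence the constant 1. In general
  \<open>|x|^\<alpha> \<le> (3/2) |x - \<gamma>|^\<alpha> + A |\<gamma>|^\<alpha>\<close> leaves the integrable factor
  \<open>c exp(-(b/2) |x - \<gamma>|^\<alpha>)\<close>, whose mass is the constant.
\<close>

section \<open>Stretched exponentials: integrability, moments and positivity\<close>

definition stretched_exp :: "real \<Rightarrow> real \<Rightarrow> real \<Rightarrow> real" where
  "stretched_exp \<alpha> b x = exp (- b * \<bar>x\<bar> powr \<alpha>)"

lemma stretched_exp_pos [simp]: "stretched_exp \<alpha> b x > 0"
  by (simp add: stretched_exp_def)

lemma stretched_exp_nonneg [simp]: "stretched_exp \<alpha> b x \<ge> 0"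
  by (simp add: stretched_exp_def)

lemma stretched_exp_minus [simp]: "stretched_exp \<alpha> b (- x) = stretched_exp \<alpha> b x"
  by (simp add: stretched_exp_def)

lemma borel_measurable_stretched_exp [measurable]:
  "stretched_exp \<alpha> b \<in> borel_measurable borel"
  unfolding stretched_exp_def by measurable

lemma stretched_exp_scale:
  "\<sigma> > 0 \<Longrightarrow> stretched_exp \<alpha> b (\<sigma> * x) = stretched_exp \<alpha> (b * \<sigma> powr \<alpha>) x"
  by (simp add: stretched_exp_def abs_mult powr_mult mult_ac)

lemma integrable_inverse_one_plus_square_lborel:
  "integrable lborel (\<lambda>x::real. inverse (1 + x\<^sup>2))"
  using integrable_inverse_1_plus_square by (simp add: set_integrable_def einterval_def)

text \<open>Put \<open>y = b * |x| powr \<alpha>\<close> and \<open>q = 4 / \<alpha>\<close>: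
  raising \<open>y / q \<le> exp (y / q)\<close> to the power \<open>q\<close> compares a multiple
  of \<open>x ^ 4\<close> with \<open>exp y\<close>. The fourth power is what the weight
  \<open>1 + x^2\<close> needs to reach an integrable majorant.\<close>

lemma pow4_mult_stretched_exp_le:
  assumes "\<alpha> > 0" "b > 0"
  shows "x ^ 4 * stretched_exp \<alpha> b x \<le> (4 / (\<alpha> * b)) powr (4 / \<alpha>)"
proof (cases "x = 0")
  case False
  define q where "q = 4 / \<alpha>"
  have q: "q > 0" using assms by (simp add: q_def)
  let ?y = "b * \<bar>x\<bar> powr \<alpha>"
  have "(b / q) powr q * x ^ 4 = (?y / q) powr q"
  proof -
    have "(\<bar>x\<bar> powr \<alpha>) powr q = \<bar>x\<bar> powr 4"
      using assms by (simp add: powr_powr q_def)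
    also have "\<dots> = x ^ 4" using False by (simp add: powr_numeral)
    finally show ?thesis using assms q
      by (simp add: powr_mult powr_divide)
  qed
  also have "\<dots> \<le> exp (?y / q) powr q"
  proof (rule powr_mono2)
    show "?y / q \<le> exp (?y / q)" using exp_ge_add_one_self[of "?y / q"] by linarith
  qed (use assms q in auto)
  also have "\<dots> = exp ?y" using q by (simp add: powr_def)
  finally have le: "(b / q) powr q * x ^ 4 \<le> exp ?y" .
  have "x ^ 4 * stretched_exp \<alpha> b x = x ^ 4 / exp ?y"
    by (simp add: stretched_exp_def exp_minus divide_inverse)
  also have "\<dots> \<le> 1 / (b / q) powr q"
    using le assms q by (simp add: field_simps)
  also have "\<dots> = (q / b) powr q"
    using assms q by (simp add: powr_divide)
  also have "q / b = 4 / (\<alpha> * b)" by (simp add: q_def)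
  finally show ?thesis by (simp add: q_def)
qed simp

text \<open>The weight treats mass and second moment at once. The majorant is a multiple of the
  Cauchy density: \<open>(1 + x^2)^2 \<le> 2 + 2 * x^4\<close>, and both terms stay bounded after
  multiplication by the stretched exponential.\<close>

lemma integrable_stretched_exp_weighted:
  assumes "\<alpha> > 0" "b > 0"
  shows "integrable lborel (\<lambda>x. (1 + x\<^sup>2) * stretched_exp \<alpha> b x)"
proof -
  define K where "K = 2 + 2 * (4 / (\<alpha> * b)) powr (4 / \<alpha>)"
  have le: "(1 + x\<^sup>2) * stretched_exp \<alpha> b x \<le> K * inverse (1 + x\<^sup>2)" for x
  proof -
    have "(1 + x\<^sup>2)\<^sup>2 \<le> 2 + 2 * x ^ 4"
      using zero_le_power2[of "x\<^sup>2 - 1"] by (simp add: power2_eq_square power4_eq_xxxx algebra_simps)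
    hence "(1 + x\<^sup>2)\<^sup>2 * stretched_exp \<alpha> b x \<le> (2 + 2 * x ^ 4) * stretched_exp \<alpha> b x"
      by (rule mult_right_mono) simp
    also have "\<dots> = 2 * stretched_exp \<alpha> b x + 2 * (x ^ 4 * stretched_exp \<alpha> b x)"
      by (simp add: algebra_simps)
    also have "\<dots> \<le> 2 * 1 + 2 * (4 / (\<alpha> * b)) powr (4 / \<alpha>)"
      by (intro add_mono mult_left_mono pow4_mult_stretched_exp_le assms)
        (use assms in \<open>auto simp: stretched_exp_def\<close>)
    finally have "(1 + x\<^sup>2)\<^sup>2 * stretched_exp \<alpha> b x \<le> K" by (simp add: K_def)
    moreover have "1 + x\<^sup>2 > 0" by (simp add: add_pos_nonneg)
    ultimately show ?thesis
      by (simp add: field_simps power2_eq_square)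
  qed
  show ?thesis
  proof (rule Bochner_Integration.integrable_bound)
    show "integrable lborel (\<lambda>x. K * inverse (1 + x\<^sup>2))"
      using integrable_inverse_one_plus_square_lborel by simp
    show "AE x in lborel. norm ((1 + x\<^sup>2) * stretched_exp \<alpha> b x) \<le> norm (K * inverse (1 + x\<^sup>2))"
    proof (rule AE_I2)
      fix x
      have "(1 + x\<^sup>2) * stretched_exp \<alpha> b x \<ge> 0" by simp
      with le[of x] show "norm ((1 + x\<^sup>2) * stretched_exp \<alpha> b x) \<le> norm (K * inverse (1 + x\<^sup>2))"
        unfolding real_norm_def by linarith
    qed
  qed measurable
qed

lemma integrable_stretched_exp:
  assumes "\<alpha> > 0" "b > 0"
  shows "integrable lborel (stretched_exp \<alpha> b)"
    and "integrable lborel (\<lambda>x. x\<^sup>2 * stretched_exp \<alpha> b x)"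
  by (rule Bochner_Integration.integrable_bound[OF integrable_stretched_exp_weighted[OF assms]];
      simp add: abs_mult; simp add: algebra_simps)+

text \<open>A vanishing integral would force \<open>g = 0\<close> almost everywhere, but
  \<open>g\<close> can vanish only at one point. The exception at 0 admits the second-moment
  integrand, which is zero there.\<close>

lemma integral_lborel_pos:
  fixes g :: "real \<Rightarrow> real"
  assumes "integrable lborel g" "\<And>x. g x \<ge> 0" "\<And>x. x \<noteq> 0 \<Longrightarrow> g x > 0"
  shows "(\<integral>x. g x \<partial>lborel) > 0"
proof (rule ccontr)
  assume "\<not> ?thesis"
  hence "(\<integral>x. g x \<partial>lborel) = 0"
    using integral_nonneg_AE[of g lborel] assms(2) by (auto intro!: antisym)
  hence "AE x in lborel. g x = 0"
    using integral_nonneg_eq_0_iff_AE[OF assms(1)] assms(2) by simp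
  with AE_lborel_singleton[of 0] have "AE x :: real in lborel. False"
    by eventually_elim (use assms(3) in force)
  thus False by (simp add: AE_iff_measurable[OF _ refl])
qed

lemma integral_stretched_exp_pos:
  assumes "\<alpha> > 0" "b > 0"
  shows "(\<integral>x. stretched_exp \<alpha> b x \<partial>lborel) > 0"
    and "(\<integral>x. x\<^sup>2 * stretched_exp \<alpha> b x \<partial>lborel) > 0"
  using integrable_stretched_exp[OF assms] by (auto intro!: integral_lborel_pos)

text \<open>Applied to the fractions \<open>s / (s + t)\<close> for subadditivity of powers, and to
  probabilities for the tail bound.\<close>

lemma le_powr_self:
  fixes p \<theta> :: real
  assumes "0 \<le> p" "p \<le> 1" "\<theta> \<le> 1"
  shows "p \<le> p powr \<theta>"
  using powr_mono'[of \<theta> 1 p] assms by simp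

section \<open>Translation invariance and the chi-square divergence of densities\<close>

lemma nn_integral_lborel_shift:
  fixes f :: "real \<Rightarrow> real"
  assumes [measurable]: "f \<in> borel_measurable borel"
  shows "(\<integral>\<^sup>+x. ennreal (f (x - \<gamma>)) \<partial>lborel) = (\<integral>\<^sup>+x. ennreal (f x) \<partial>lborel)"
  using nn_integral_real_affine[of "\<lambda>x. ennreal (f x)" 1 "- \<gamma>"] by simp

text \<open>With \<open>r = g / f\<close>, integrate \<open>(r - 1)^2 + 2 * r = r^2 + 1\<close>
  against \<open>Q\<close>; both \<open>r\<close> and 1 have integral 1. The identity has no
  subtraction of integrals, so it stays valid in \<open>ennreal\<close> when the divergence is
  infinite.\<close>

lemma one_plus_chi_square_density:
  fixes f g :: "real \<Rightarrow> real"
  assumes [measurable]: "f \<in> borel_measurable borel" "g \<in> borel_measurable borel"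
    and f0: "\<And>x. f x > 0" and g0: "\<And>x. g x \<ge> 0"
    and f1: "(\<integral>\<^sup>+x. ennreal (f x) \<partial>lborel) = 1" and g1: "(\<integral>\<^sup>+x. ennreal (g x) \<partial>lborel) = 1"
  shows "1 + chi_square (density lborel (\<lambda>x. ennreal (g x))) (density lborel (\<lambda>x. ennreal (f x)))
    = (\<integral>\<^sup>+x. ennreal ((g x)\<^sup>2 / f x) \<partial>lborel)"
proof -
  define Q where "Q = density lborel (\<lambda>x. ennreal (f x))"
  define P where "P = density lborel (\<lambda>x. ennreal (g x))"
  have [measurable_cong]: "sets Q = sets borel" by (simp add: Q_def)
  define r where "r = (\<lambda>x. g x / f x)"
  have r0: "r x \<ge> 0" for x using f0[of x] g0[of x] by (simp add: r_def)
  have fr: "f x * r x = g x" for x using f0[of x] by (simp add: r_def)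
  have [measurable]: "r \<in> borel_measurable borel" unfolding r_def by measurable
  \<comment> \<open>As \<open>f\<close> vanishes nowhere, \<open>r\<close> is a density of
    \<open>P\<close> with respect to \<open>Q\<close>; this yields both absolute continuity and the
    Radon-Nikodym derivative.\<close>
  have P: "density Q (\<lambda>x. ennreal (r x)) = P"
    unfolding Q_def P_def
    by (subst density_density_eq)
      (auto simp: ennreal_mult'[symmetric] less_imp_le[OF f0] fr)
  have ac: "absolutely_continuous Q P"
    unfolding P[symmetric] by (rule absolutely_continuousI_density) (simp add: Q_def)
  interpret Q: prob_space Q
    by (rule prob_spaceI) (simp add: Q_def emeasure_density f1)
  have "AE x in Q. ennreal (r x) = RN_deriv Q P x"
    by (rule Q.RN_deriv_unique[OF _ P]) (simp add: Q_def)
  hence chi: "chi_square P Q = (\<integral>\<^sup>+x. ennreal ((r x - 1)\<^sup>2) \<partial>Q)"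
    unfolding chi_square_def using ac r0
    by (auto intro!: nn_integral_cong_AE elim!: eventually_mono) (metis enn2real_ennreal)
  have r1: "(\<integral>\<^sup>+x. ennreal (r x) \<partial>Q) = 1"
    unfolding Q_def
    by (subst nn_integral_density) (auto simp: ennreal_mult'[symmetric] less_imp_le[OF f0] fr g1)
  have "chi_square P Q + 2 = (\<integral>\<^sup>+x. ennreal ((r x - 1)\<^sup>2) + 2 * ennreal (r x) \<partial>Q)"
    by (simp add: nn_integral_add chi nn_integral_cmult r1)
  also have "\<dots> = (\<integral>\<^sup>+x. ennreal ((r x)\<^sup>2) + 1 \<partial>Q)"
  proof (rule nn_integral_cong)
    fix x
    have "ennreal ((r x - 1)\<^sup>2) + 2 * ennreal (r x) = ennreal ((r x - 1)\<^sup>2 + 2 * r x)"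
      using r0 by (simp add: ennreal_mult)
    also have "(r x - 1)\<^sup>2 + 2 * r x = (r x)\<^sup>2 + 1" by (simp add: power2_eq_square algebra_simps)
    finally show "ennreal ((r x - 1)\<^sup>2) + 2 * ennreal (r x) = ennreal ((r x)\<^sup>2) + 1" by simp
  qed
  also have "\<dots> = (\<integral>\<^sup>+x. ennreal ((r x)\<^sup>2) \<partial>Q) + 1"
    by (simp add: nn_integral_add Q.emeasure_space_1)
  finally have "1 + (1 + chi_square P Q) = 1 + (\<integral>\<^sup>+x. ennreal ((r x)\<^sup>2) \<partial>Q)"
    by (simp add: ac_simps add.assoc[symmetric])
  \<comment> \<open>Only the finite summand 1 is cancelled, which is legitimate even if the other
    terms are infinite.\<close>
  hence "1 + chi_square P Q = (\<integral>\<^sup>+x. ennreal ((r x)\<^sup>2) \<partial>Q)"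
    by (metis ennreal_add_left_cancel ennreal_one_neq_top infinity_ennreal_def)
  also have "\<dots> = (\<integral>\<^sup>+x. ennreal ((g x)\<^sup>2 / f x) \<partial>lborel)"
    unfolding Q_def
    by (subst nn_integral_density)
      (auto simp: ennreal_mult'[symmetric] less_imp_le[OF f0] r_def power2_eq_square
        intro!: nn_integral_cong arg_cong[where f = ennreal])
  finally show ?thesis by (simp add: P_def Q_def)
qed

section \<open>Inequalities for powers of sums\<close>

text \<open>Divide by \<open>(s + t) powr \<alpha>\<close>: the fractions of \<open>s\<close> and
  \<open>t\<close> sum to 1, and each is at most its own power since
  \<open>\<alpha> \<le> 1\<close>.\<close>

lemma powr_add_le:
  fixes s t \<alpha> :: real
  assumes "0 < \<alpha>" "\<alpha> \<le> 1" "s \<ge> 0" "t \<ge> 0"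
  shows "(s + t) powr \<alpha> \<le> s powr \<alpha> + t powr \<alpha>"
proof (cases "s + t = 0")
  case False
  have *: "x / (s + t) \<le> (x / (s + t)) powr \<alpha>" if "x \<ge> 0" "x \<le> s + t" for x
    by (rule le_powr_self) (use that assms False in \<open>auto simp: field_simps\<close>)
  have "1 = s / (s + t) + t / (s + t)" using False by (simp add: add_divide_distrib[symmetric])
  also have "\<dots> \<le> (s / (s + t)) powr \<alpha> + (t / (s + t)) powr \<alpha>"
    by (intro add_mono *) (use assms in auto)
  also have "\<dots> = (s powr \<alpha> + t powr \<alpha>) / (s + t) powr \<alpha>"
    using assms by (simp add: powr_divide add_divide_distrib)
  finally show ?thesis using False assms by (simp add: field_simps)
qed (use assms in auto)

text \<open>Split at \<open>|y| = \<delta> * |x|\<close>. For smaller \<open>y\<close> the sum is at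
  most \<open>(1 + \<delta>) * |x|\<close>; for larger \<open>y\<close> it is at most
  \<open>(1 + 1 / \<delta>) * |y|\<close>. Each case uses only one term of the right-hand
  side.\<close>

lemma abs_add_powr_le:
  fixes \<alpha> \<epsilon> :: real
  assumes "\<alpha> > 0" "\<epsilon> > 0"
  obtains A where "A > 0"
    "\<And>x y::real. \<bar>x + y\<bar> powr \<alpha> \<le> (1 + \<epsilon>) * \<bar>x\<bar> powr \<alpha> + A * \<bar>y\<bar> powr \<alpha>"
proof -
  \<comment> \<open>Chosen so that \<open>(1 + \<delta>) powr \<alpha>\<close> is exactly
    \<open>1 + \<epsilon>\<close>.\<close>
  define \<delta> where "\<delta> = (1 + \<epsilon>) powr (1 / \<alpha>) - 1"
  have \<delta>: "\<delta> > 0" unfolding \<delta>_def using assms by simp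
  have \<delta>_powr: "(1 + \<delta>) powr \<alpha> = 1 + \<epsilon>"
    using assms by (simp add: \<delta>_def powr_powr)
  define A where "A = (1 + 1 / \<delta>) powr \<alpha>"
  show ?thesis
  proof (rule that)
    have "1 + 1 / \<delta> > 0" using \<delta> by (simp add: add_pos_pos)
    thus "A > 0" by (simp add: A_def)
  next
    fix x y :: real
    show "\<bar>x + y\<bar> powr \<alpha> \<le> (1 + \<epsilon>) * \<bar>x\<bar> powr \<alpha> + A * \<bar>y\<bar> powr \<alpha>"
    proof (cases "\<bar>y\<bar> \<le> \<delta> * \<bar>x\<bar>")
      case True
      have "\<bar>x + y\<bar> powr \<alpha> \<le> ((1 + \<delta>) * \<bar>x\<bar>) powr \<alpha>"
        by (rule powr_mono2) (use True assms in \<open>auto simp: algebra_simps\<close>)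
      also have "\<dots> = (1 + \<epsilon>) * \<bar>x\<bar> powr \<alpha>"
        using \<delta> by (simp add: powr_mult \<delta>_powr)
      finally show ?thesis by (simp add: A_def add_increasing2)
    next
      case False
      have "\<bar>x\<bar> \<le> \<bar>y\<bar> / \<delta>" using False \<delta> by (simp add: field_simps)
      hence "\<bar>x + y\<bar> powr \<alpha> \<le> ((1 + 1 / \<delta>) * \<bar>y\<bar>) powr \<alpha>"
        by (intro powr_mono2) (use assms in \<open>auto simp: algebra_simps\<close>)
      also have "\<dots> = A * \<bar>y\<bar> powr \<alpha>"
        using \<delta> by (simp add: powr_mult A_def)
      finally show ?thesis using assms by (simp add: add_increasing)
    qed
  qed
qed

section \<open>Tails, normalisation and membership in \<open>class_G\<close>\<close>

text \<open>Since \<open>\<tau>\<close> is free, an exponential moment at any rate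
  \<open>\<beta>\<close> suffices for the tail condition of \<open>class_G\<close>, including its
  fixed prefactor 2.\<close>

lemma exp_moment_tail_bound:
  fixes M :: "real measure"
  assumes "prob_space M" and [simp]: "sets M = sets borel" and "\<alpha> > 0" "\<beta> > 0"
    and int: "integrable M (\<lambda>w. exp (\<beta> * \<bar>w\<bar> powr \<alpha>))"
  obtains \<tau> where "\<tau> > 0"
    "\<And>t. t \<ge> 0 \<Longrightarrow> measure M {w. \<bar>w\<bar> \<ge> t} \<le> 2 * exp (- 2 * (t / \<tau>) powr \<alpha>)"
proof -
  interpret prob_space M by fact
  have [simp]: "space M = UNIV" using sets_eq_imp_space_eq[OF assms(2)] by simp
  define E where "E = expectation (\<lambda>w. exp (\<beta> * \<bar>w\<bar> powr \<alpha>))"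
  have E1: "E \<ge> 1"
  proof -
    have "expectation (\<lambda>w. 1) \<le> E"
      unfolding E_def by (rule integral_mono) (use int assms(4) in auto)
    thus ?thesis using prob_space by simp
  qed
  txt \<open>
    Markov's inequality only gives the prefactor \<open>E\<close>; as \<open>p \<le> p powr \<theta>\<close> for probabilities,
    raising it to a small power \<open>\<theta>\<close> brings the prefactor below 2 at the cost of a larger \<open>\<tau>\<close>.
  \<close>
  define \<theta> where "\<theta> = 1 / (2 * E)"
  have \<theta>: "0 < \<theta>" "\<theta> \<le> 1" using E1 by (simp_all add: \<theta>_def)
  have E_powr: "E powr \<theta> \<le> 2"
  proof -
    have "ln E \<le> E" using ln_le_minus_one[of E] E1 by simp
    hence "\<theta> * ln E \<le> 1 / 2" using E1 by (simp add: \<theta>_def field_simps)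
    hence "E powr \<theta> \<le> exp (1 / 2)" using E1 by (simp add: powr_def)
    also have "\<dots> \<le> 2" using exp_half_le2 by simp
    finally show ?thesis .
  qed
  \<comment> \<open>Solves \<open>\<theta> * \<beta> * t powr \<alpha> = 2 * (t / \<tau>) powr
    \<alpha>\<close> for all \<open>t \<ge> 0\<close> simultaneously.\<close>
  define \<tau> where "\<tau> = (2 / (\<theta> * \<beta>)) powr (1 / \<alpha>)"
  have \<tau>: "\<tau> > 0" "\<tau> powr \<alpha> = 2 / (\<theta> * \<beta>)"
    using assms \<theta> by (simp_all add: \<tau>_def powr_powr)
  show ?thesis
  proof (rule that)
    fix t :: real assume t: "t \<ge> 0"
    let ?p = "measure M {w. \<bar>w\<bar> \<ge> t}"
    let ?c = "exp (\<beta> * t powr \<alpha>)"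
    have "?p \<le> measure M {w \<in> space M. exp (\<beta> * \<bar>w\<bar> powr \<alpha>) \<ge> ?c}"
    proof (rule finite_measure_mono)
      show "{w. \<bar>w\<bar> \<ge> t} \<subseteq> {w \<in> space M. exp (\<beta> * \<bar>w\<bar> powr \<alpha>) \<ge> ?c}"
        using t assms by (auto intro!: powr_mono2)
      show "{w \<in> space M. exp (\<beta> * \<bar>w\<bar> powr \<alpha>) \<ge> ?c} \<in> events"
        by simp
    qed
    also have "\<dots> \<le> E / ?c"
      unfolding E_def by (rule integral_Markov_inequality_measure[where A = "{}"]) (use int in auto)
    finally have p: "?p \<le> E / ?c" .
    have "?p \<le> ?p powr \<theta>"
      by (rule le_powr_self) (use \<theta> in auto)
    also have "\<dots> \<le> (E / ?c) powr \<theta>"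
      by (rule powr_mono2) (use \<theta> p in auto)
    also have "\<dots> = E powr \<theta> * exp (- (\<theta> * \<beta> * t powr \<alpha>))"
      using E1 by (simp add: powr_divide exp_powr_real exp_minus inverse_eq_divide mult_ac)
    also have "\<dots> \<le> 2 * exp (- (\<theta> * \<beta> * t powr \<alpha>))"
      using E_powr by (rule mult_right_mono) simp
    also have "\<theta> * \<beta> * t powr \<alpha> = 2 * (t / \<tau>) powr \<alpha>"
      using \<tau> t \<theta> assms by (simp add: powr_divide)
    finally show "?p \<le> 2 * exp (- 2 * (t / \<tau>) powr \<alpha>)" by simp
  qed (fact \<tau>)
qed

text \<open>If \<open>X\<close> has density \<open>stretched_exp \<alpha> 1 x / Z\<close>, its
  variance is \<open>V / Z = \<sigma>^2\<close>, and \<open>X / \<sigma>\<close> has unit variance.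
  Its density gives the witnesses \<open>b = \<sigma> powr \<alpha>\<close> and
  \<open>c = \<sigma> / Z\<close>.\<close>

lemma standardized_stretched_exp:
  assumes "\<alpha> > 0"
  obtains b c where "b > 0" "c > 0"
    "(\<integral>x. c * stretched_exp \<alpha> b x \<partial>lborel) = 1"
    "(\<integral>x. x\<^sup>2 * (c * stretched_exp \<alpha> b x) \<partial>lborel) = 1"
proof -
  define Z where "Z = (\<integral>x. stretched_exp \<alpha> 1 x \<partial>lborel)"
  define V where "V = (\<integral>x. x\<^sup>2 * stretched_exp \<alpha> 1 x \<partial>lborel)"
  define \<sigma> where "\<sigma> = sqrt (V / Z)"
  have pos: "Z > 0" "V > 0" "\<sigma> > 0"
    using integral_stretched_exp_pos[OF assms, of 1] by (simp_all add: Z_def V_def \<sigma>_def)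
  have \<sigma>2: "\<sigma>\<^sup>2 = V / Z" using pos by (simp add: \<sigma>_def)
  have Z: "Z = \<sigma> * (\<integral>x. stretched_exp \<alpha> (\<sigma> powr \<alpha>) x \<partial>lborel)"
    using lborel_integral_real_affine[of \<sigma> "stretched_exp \<alpha> 1" 0] pos
    by (simp add: Z_def stretched_exp_scale)
  have V: "V = \<sigma> * (\<sigma>\<^sup>2 * (\<integral>x. x\<^sup>2 * stretched_exp \<alpha> (\<sigma> powr \<alpha>) x \<partial>lborel))"
    using lborel_integral_real_affine[of \<sigma> "\<lambda>x. x\<^sup>2 * stretched_exp \<alpha> 1 x" 0] pos
    by (simp add: V_def stretched_exp_scale power_mult_distrib mult.assoc)
  show ?thesis
  proof (rule that[of "\<sigma> powr \<alpha>" "\<sigma> / Z"])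
    show "(\<integral>x. \<sigma> / Z * stretched_exp \<alpha> (\<sigma> powr \<alpha>) x \<partial>lborel) = 1"
    proof -
      have "\<sigma> / Z * (\<integral>x. stretched_exp \<alpha> (\<sigma> powr \<alpha>) x \<partial>lborel) = Z / Z"
        by (subst (2) Z) simp
      also have "\<dots> = 1" using pos by simp
      finally show ?thesis by (simp only: integral_mult_right_zero)
    qed
    have "(\<integral>x. x\<^sup>2 * (\<sigma> / Z * stretched_exp \<alpha> (\<sigma> powr \<alpha>) x) \<partial>lborel)
        = \<sigma> / Z * (\<integral>x. x\<^sup>2 * stretched_exp \<alpha> (\<sigma> powr \<alpha>) x \<partial>lborel)"
      by (subst integral_mult_right_zero[symmetric]) (simp add: mult_ac)
    also have "\<dots> = V / (\<sigma>\<^sup>2 * Z)" by (subst V) (use pos in simp)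
    also have "\<dots> = 1" using pos \<sigma>2 by simp
    finally show "(\<integral>x. x\<^sup>2 * (\<sigma> / Z * stretched_exp \<alpha> (\<sigma> powr \<alpha>) x) \<partial>lborel) = 1" .
  qed (use pos in auto)
qed

text \<open>Symmetry combines evenness of \<open>f\<close> with reflection invariance of Lebesgue
  measure; the tail condition comes from an exponential moment.\<close>

lemma density_stretched_exp_in_class_G:
  assumes "\<alpha> > 0" "b > 0" "c > 0"
    and f_def: "f = (\<lambda>x. c * stretched_exp \<alpha> b x)"
    and mass: "(\<integral>x. f x \<partial>lborel) = 1"
    and var: "(\<integral>x. x\<^sup>2 * f x \<partial>lborel) = 1"
  obtains \<tau> where "\<tau> > 0" "density lborel (\<lambda>x. ennreal (f x)) \<in> class_G \<alpha> \<tau>"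
proof -
  let ?M = "density lborel (\<lambda>x. ennreal (f x))"
  have f0: "f x \<ge> 0" for x using assms(3) by (simp add: f_def)
  have [measurable]: "f \<in> borel_measurable borel" by (simp add: f_def)
  have int: "integrable lborel f" "integrable lborel (\<lambda>x. x\<^sup>2 * f x)"
    using integrable_stretched_exp[OF assms(1,2)]
    by (auto simp: f_def mult.left_commute[of _ c])
  have "prob_space ?M"
    by (rule prob_spaceI) (simp add: emeasure_density nn_integral_eq_integral int f0 mass)
  moreover have "distr ?M borel (\<lambda>w. - w) = ?M"
    using density_distr[of "\<lambda>x. ennreal (f x)" borel uminus lborel]
    by (simp add: lborel_distr_uminus f_def)
  moreover have "integrable ?M (\<lambda>w. w\<^sup>2)"
    by (subst integrable_density) (auto simp: f0 int(2)[unfolded mult.commute[of "_\<^sup>2"]])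
  moreover have "(\<integral>w. w\<^sup>2 \<partial>?M) = 1"
    by (subst integral_density) (auto simp: f0 var[unfolded mult.commute[of "_\<^sup>2"]])
  \<comment> \<open>Any positive rate below \<open>b\<close> would do; \<open>b / 2\<close> leaves
    half of the decay for integrability.\<close>
  moreover have exp_int: "integrable ?M (\<lambda>w. exp (b / 2 * \<bar>w\<bar> powr \<alpha>))"
  proof -
    have "f x * exp (b / 2 * \<bar>x\<bar> powr \<alpha>) = c * stretched_exp \<alpha> (b / 2) x" for x
      by (simp add: f_def stretched_exp_def mult_exp_exp)
    thus ?thesis
      by (subst integrable_density) (use f0 integrable_stretched_exp(1)[of \<alpha> "b / 2"] assms(1,2) in auto)
  qed
  moreover obtain \<tau> where "\<tau> > 0"
      "\<And>t. t \<ge> 0 \<Longrightarrow> measure ?M {w. \<bar>w\<bar> \<ge> t} \<le> 2 * exp (- 2 * (t / \<tau>) powr \<alpha>)"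
    using exp_moment_tail_bound[OF \<open>prob_space ?M\<close> _ assms(1) _ exp_int] assms(2) by auto
  ultimately show ?thesis
    by (intro that[of \<tau>]) (auto simp: class_G_def)
qed

section \<open>The second-moment integral of the likelihood ratio under a shift\<close>

lemma nn_integral_stretched_exp_shift_le:
  assumes "\<alpha> > 0" "b > 0" "c > 0"
    and f_def: "f = (\<lambda>x. c * stretched_exp \<alpha> b x)"
    and mass: "(\<integral>\<^sup>+x. ennreal (f x) \<partial>lborel) = 1"
  obtains C K where "C > 0" "K > 0" "\<alpha> \<le> 1 \<or> \<alpha> = 2 \<longrightarrow> C = 1"
    "\<And>\<gamma>. (\<integral>\<^sup>+x. ennreal ((f (x - \<gamma>))\<^sup>2 / f x) \<partial>lborel) \<le> ennreal (C * exp (K * \<bar>\<gamma>\<bar> powr \<alpha>))"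
proof -
  \<comment> \<open>Common core of the three cases: the integrand is dominated by \<open>D\<close>
    times a translate of \<open>h\<close>, whose mass \<open>C\<close> does not depend on the
    translation. The offset \<open>s\<close> is separate from \<open>\<gamma>\<close> because the
    Gaussian case translates by \<open>2 * \<gamma>\<close>.\<close>
  have shift_bound: "(\<integral>\<^sup>+x. ennreal ((f (x - \<gamma>))\<^sup>2 / f x) \<partial>lborel) \<le> ennreal (C * D)"
    if "\<And>x. (f (x - \<gamma>))\<^sup>2 / f x \<le> D * h (x - s)" and "(\<integral>\<^sup>+x. ennreal (h x) \<partial>lborel) = ennreal C"
      and "D \<ge> 0" "\<And>x. h x \<ge> 0" "C \<ge> 0" and [measurable]: "h \<in> borel_measurable borel"
    for \<gamma> C D s and h :: "real \<Rightarrow> real"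
  proof -
    have "(\<integral>\<^sup>+x. ennreal ((f (x - \<gamma>))\<^sup>2 / f x) \<partial>lborel) \<le> (\<integral>\<^sup>+x. ennreal D * ennreal (h (x - s)) \<partial>lborel)"
      using that by (intro nn_integral_mono) (simp add: ennreal_mult'[symmetric] ennreal_leI)
    also have "\<dots> = ennreal D * (\<integral>\<^sup>+x. ennreal (h (x - s)) \<partial>lborel)"
      by (rule nn_integral_cmult) measurable
    also have "\<dots> = ennreal (C * D)"
      using that by (simp add: nn_integral_lborel_shift ennreal_mult mult.commute)
    finally show ?thesis .
  qed
  have ratio: "(f (x - \<gamma>))\<^sup>2 / f x = c * exp (b * \<bar>x\<bar> powr \<alpha> - 2 * b * \<bar>x - \<gamma>\<bar> powr \<alpha>)" for x \<gamma>
    using assms(3) by (simp add: f_def stretched_exp_def power2_eq_square field_simps exp_diff exp_minus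
       exp_add[symmetric])
  have [measurable]: "f \<in> borel_measurable borel" by (simp add: f_def)
  have f0: "f x \<ge> 0" for x using assms(3) by (simp add: f_def)
  consider "\<alpha> \<le> 1" | "\<alpha> = 2" | "\<alpha> > 1" "\<alpha> \<noteq> 2" by linarith
  thus ?thesis
  proof cases
    case 1
    have "(f (x - \<gamma>))\<^sup>2 / f x \<le> exp (b * \<bar>\<gamma>\<bar> powr \<alpha>) * f (x - \<gamma>)" for x \<gamma>
    proof -
      have "\<bar>x\<bar> powr \<alpha> \<le> (\<bar>x - \<gamma>\<bar> + \<bar>\<gamma>\<bar>) powr \<alpha>"
        by (rule powr_mono2) (use assms in auto)
      also have "\<dots> \<le> \<bar>x - \<gamma>\<bar> powr \<alpha> + \<bar>\<gamma>\<bar> powr \<alpha>"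
        by (rule powr_add_le) (use assms 1 in auto)
      finally have "b * \<bar>x\<bar> powr \<alpha> \<le> b * (\<bar>x - \<gamma>\<bar> powr \<alpha> + \<bar>\<gamma>\<bar> powr \<alpha>)"
        using assms(2) by simp
      thus ?thesis unfolding ratio using assms(3)
        by (simp add: f_def stretched_exp_def mult_exp_exp algebra_simps)
    qed
    hence "(\<integral>\<^sup>+x. ennreal ((f (x - \<gamma>))\<^sup>2 / f x) \<partial>lborel) \<le> ennreal (1 * exp (b * \<bar>\<gamma>\<bar> powr \<alpha>))" for \<gamma>
      by (rule shift_bound) (use mass f0 in auto)
    thus ?thesis by (intro that[of 1 b]) (use assms in auto)
  next
    case 2
    \<comment> \<open>The exponents agree by \<open>x^2 - 2 * (x - \<gamma>)^2 = 2 * \<gamma>^2 - (x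
      - 2 * \<gamma>)^2\<close>.\<close>
    have "(f (x - \<gamma>))\<^sup>2 / f x \<le> exp (2 * b * \<bar>\<gamma>\<bar> powr \<alpha>) * f (x - 2 * \<gamma>)" for x \<gamma>
      unfolding ratio using assms(3) 2
      by (simp add: f_def stretched_exp_def mult_exp_exp power2_eq_square algebra_simps)
    hence "(\<integral>\<^sup>+x. ennreal ((f (x - \<gamma>))\<^sup>2 / f x) \<partial>lborel) \<le> ennreal (1 * exp (2 * b * \<bar>\<gamma>\<bar> powr \<alpha>))" for \<gamma>
      by (rule shift_bound) (use mass f0 in auto)
    thus ?thesis by (intro that[of 1 "2 * b"]) (use assms in auto)
  next
    case 3
    \<comment> \<open>Any \<open>\<epsilon> < 1\<close> keeps the remaining decay rate
      \<open>2 * b - (1 + \<epsilon>) * b\<close> positive; \<open>1 / 2\<close> makes it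
      \<open>b / 2\<close>, the rate in \<open>h\<close>.\<close>
    obtain A where A: "A > 0"
      "\<And>x y::real. \<bar>x + y\<bar> powr \<alpha> \<le> (1 + 1 / 2) * \<bar>x\<bar> powr \<alpha> + A * \<bar>y\<bar> powr \<alpha>"
      using abs_add_powr_le[of \<alpha> "1 / 2"] assms(1) by auto
    define h where "h = (\<lambda>x. c * stretched_exp \<alpha> (b / 2) x)"
    define C where "C = (\<integral>x. h x \<partial>lborel)"
    have C: "C > 0"
      using integral_stretched_exp_pos(1)[of \<alpha> "b / 2"] assms by (simp add: C_def h_def)
    have h0: "h x \<ge> 0" for x using assms(3) by (simp add: h_def)
    have "integrable lborel h"
      using integrable_stretched_exp(1)[of \<alpha> "b / 2"] assms by (simp add: h_def)
    hence h: "(\<integral>\<^sup>+x. ennreal (h x) \<partial>lborel) = ennreal C"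
      unfolding C_def by (rule nn_integral_eq_integral) (simp add: h0)
    have "(f (x - \<gamma>))\<^sup>2 / f x \<le> exp (b * A * \<bar>\<gamma>\<bar> powr \<alpha>) * h (x - \<gamma>)" for x \<gamma>
    proof -
      have "b * \<bar>x\<bar> powr \<alpha> \<le> b * ((1 + 1 / 2) * \<bar>x - \<gamma>\<bar> powr \<alpha> + A * \<bar>\<gamma>\<bar> powr \<alpha>)"
        using A(2)[of "x - \<gamma>" \<gamma>] assms(2) by simp
      thus ?thesis unfolding ratio using assms(3)
        by (simp add: h_def stretched_exp_def mult_exp_exp algebra_simps)
    qed
    hence "(\<integral>\<^sup>+x. ennreal ((f (x - \<gamma>))\<^sup>2 / f x) \<partial>lborel) \<le> ennreal (C * exp (b * A * \<bar>\<gamma>\<bar> powr \<alpha>))" for \<gamma>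
      by (rule shift_bound) (use h h0 C in \<open>auto simp: h_def\<close>)
    thus ?thesis by (intro that[of C "b * A"]) (use assms A C 3 in auto)
  qed
qed

theorem lemma2:
  fixes \<alpha> :: real
  assumes "\<alpha> > 0"
  shows "\<exists>(\<tau>::real) (f :: real \<Rightarrow> real) (C1::real) (C2::real).
           \<tau> > 0 \<and> C1 > 0 \<and> C2 > 0 \<and>
           f \<in> borel_measurable borel \<and> (\<forall>x. f x \<ge> 0) \<and>
           density lborel (\<lambda>x. ennreal (f x)) \<in> class_G \<alpha> \<tau> \<and>
           (\<forall>\<gamma>::real.
              1 + chi_square (density lborel (\<lambda>x. ennreal (f (x - \<gamma>))))
                             (density lborel (\<lambda>x. ennreal (f x)))
                \<le> ennreal (C1 * exp (\<bar>\<gamma> / C2\<bar> powr \<alpha>))) \<and>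
           (\<alpha> \<le> 1 \<or> \<alpha> = 2 \<longrightarrow> C1 = 1)"
proof -
  obtain b c where bc: "b > 0" "c > 0"
    "(\<integral>x. c * stretched_exp \<alpha> b x \<partial>lborel) = 1"
    "(\<integral>x. x\<^sup>2 * (c * stretched_exp \<alpha> b x) \<partial>lborel) = 1"
    by (rule standardized_stretched_exp[OF assms])
  define f where "f = (\<lambda>x. c * stretched_exp \<alpha> b x)"
  have f0: "f x > 0" for x using bc by (simp add: f_def)
  have [measurable]: "f \<in> borel_measurable borel" by (simp add: f_def)
  have mass: "(\<integral>\<^sup>+x. ennreal (f x) \<partial>lborel) = 1"
    using bc integrable_stretched_exp(1)[OF assms bc(1)]
    by (simp add: f_def nn_integral_eq_integral)
  obtain \<tau> where \<tau>: "\<tau> > 0" "density lborel (\<lambda>x. ennreal (f x)) \<in> class_G \<alpha> \<tau>"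
    by (rule density_stretched_exp_in_class_G[OF assms bc(1,2) f_def]) (use bc in \<open>auto simp: f_def\<close>)
  obtain C K where CK: "C > 0" "K > 0" "\<alpha> \<le> 1 \<or> \<alpha> = 2 \<longrightarrow> C = 1"
    "\<And>\<gamma>. (\<integral>\<^sup>+x. ennreal ((f (x - \<gamma>))\<^sup>2 / f x) \<partial>lborel) \<le> ennreal (C * exp (K * \<bar>\<gamma>\<bar> powr \<alpha>))"
    using nn_integral_stretched_exp_shift_le[OF assms bc(1,2) f_def mass] by blast
  \<comment> \<open>Absorbs \<open>K\<close> into the scale of the shift:
    \<open>C2 powr \<alpha> = 1 / K\<close>.\<close>
  define C2 where "C2 = (1 / K) powr (1 / \<alpha>)"
  have C2: "C2 > 0" using CK by (simp add: C2_def)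
  have scale: "\<bar>\<gamma> / C2\<bar> powr \<alpha> = K * \<bar>\<gamma>\<bar> powr \<alpha>" for \<gamma>
  proof -
    have "\<bar>\<gamma> / C2\<bar> powr \<alpha> = \<bar>\<gamma>\<bar> powr \<alpha> / C2 powr \<alpha>"
      using C2 by (simp add: powr_divide)
    also have "C2 powr \<alpha> = 1 / K" using assms CK by (simp add: C2_def powr_powr)
    finally show ?thesis by simp
  qed
  have "1 + chi_square (density lborel (\<lambda>x. ennreal (f (x - \<gamma>)))) (density lborel (\<lambda>x. ennreal (f x)))
      \<le> ennreal (C * exp (\<bar>\<gamma> / C2\<bar> powr \<alpha>))" for \<gamma>
    using one_plus_chi_square_density[of f "\<lambda>x. f (x - \<gamma>)"] f0 CK(4)[of \<gamma>] mass
    unfolding scale by (simp add: nn_integral_lborel_shift less_imp_le)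
  thus ?thesis
    using \<tau> CK C2 f0 by (intro exI[of _ \<tau>] exI[of _ f] exI[of _ C] exI[of _ C2]) (auto simp: less_imp_le)
qed

end
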